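(* Let $\mathcal{X}$ be a MIF$(k)$. Then there exist at least one CIF$(k,k-1)$ $\mathcal{F}$ and a point $\alpha\in P_{\mathcal{X}}\smallsetminus P_{\mathcal{F}}$ such that $\mathcal{X}=\mathcal{F}\sqcup(\alpha\circledast\mathcal{F}^{\top})$.
   Context: A family is a set of finite sets, called its blocks; the following notation is introduced for non-empty families of non-empty sets. The point set of a family $\mathcal{G}$ is $P_{\mathcal{G}}=\bigcup_{B\in\mathcal{G}}B$. A family is uniform if all its blocks have the same size, denoted $\mathrm{k}(\mathcal{G})$. A blocking set of $\mathcal{G}$ is a set meeting every block of $\mathcal{G}$. If $\mathcal{G}$ has a finite blocking set, $\mathrm{tr}(\mathcal{G})$ is the smallest size of a blocking set, a transversal is a blocking set of size $\mathrm{tr}(\mathcal{G})$, and $\mathcal{G}^{\top}$ is the family of all transversals of $\mathcal{G}$; otherwise $\mathrm{tr}(\mathcal{G})=\infty$. The symbol $\sqcup$ denotes disjoint union (of sets or of families). If $\alpha\notin P_{\mathcal{H}}$, then $\alpha\circledast\mathcal{H}=\{\{\alpha\}\sqcup B: B\in\mathcal{H}\}$. A MIF$(k)$ (maximal intersecting family of $k$-sets) is a uniform family $\mathcal{F}$ with $\mathrm{k}(\mathcal{F})=k$, $\mathrm{tr}(\mathcal{F})<\infty$ and $\mathcal{F}=\mathcal{F}^{\top}$. A CIF$(k,t)$ (closed intersecting family) is a uniform family $\mathcal{F}$ with $\mathrm{k}(\mathcal{F})=k$, $\mathrm{tr}(\mathcal{F})=t\le k-1$ and $\mathcal{F}=(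\mathcal{F}\sqcup\mathcal{F}^{\top})^{\top}$.
   Formalization: For k=1 the claim fails if a CIF must be a non-empty family (X={{x}} is a MIF(1), but no non-empty CIF(1,0) exists); here the empty family, with tr=0 and its only transversal the empty set, is allowed as a CIF(1,0). For k≥2 nothing changes. *)

theory Defs
  imports Main "HOL-Library.Extended_Nat"
begin

definition points :: "'a set set \<Rightarrow> 'a set" where
  "points G = \<Union>G"

definition uniform_family :: "nat \<Rightarrow> 'a set set \<Rightarrow> bool" where
  "uniform_family k G \<longleftrightarrow> (\<forall>B\<in>G. finite B \<and> card B = k)"

definition blocking_set :: "'a set set \<Rightarrow> 'a set \<Rightarrow> bool" where
  "blocking_set G T \<longleftrightarrow> (\<forall>B\<in>G. T \<inter> B \<noteq> {})"

text \<open>The infimum of the empty set is infinity, so the transversal number is infinity exactly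
  when there is no finite blocking set; otherwise the infimum is attained.\<close>

definition tr :: "'a set set \<Rightarrow> enat" where
  "tr G = (INF T\<in>{T. finite T \<and> blocking_set G T}. enat (card T))"

definition transversals :: "'a set set \<Rightarrow> 'a set set" where
  "transversals G = {T. finite T \<and> blocking_set G T \<and> enat (card T) = tr G}"

text \<open>The product of a point and a family is meant for a point outside all blocks; this side
  condition has to be stated wherever the operation is used.\<close>

definition point_join :: "'a \<Rightarrow> 'a set set \<Rightarrow> 'a set set" where
  "point_join a H = {insert a B | B. B \<in> H}"

definition is_MIF :: "nat \<Rightarrow> 'a set set \<Rightarrow> bool" where
  "is_MIF k F \<longleftrightarrow> uniform_family k F \<and> tr F < \<infinity> \<and> F = transversals F"

text \<open>The condition \<open>t < k\<close> is \<open>t \<le> k - 1\<close> without truncated subtraction.\<close>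

definition is_CIF :: "nat \<Rightarrow> nat \<Rightarrow> 'a set set \<Rightarrow> bool" where
  "is_CIF k t F \<longleftrightarrow>
     uniform_family k F \<and> tr F = enat t \<and> t < k \<and>
     F \<inter> transversals F = {} \<and>
     F = transversals (F \<union> transversals F)"

text \<open>No non-emptiness is built into the definitions above. The following lemmas show that a
  maximal intersecting family, and a closed intersecting family with \<open>t > 0\<close>, is automatically a
  non-empty family of non-empty sets with a non-empty family of non-empty transversals. The only
  degenerate case is the empty family, which counts as a closed intersecting family for \<open>t = 0\<close>
  (its only transversal is the empty set). It is what remains when the point of the maximal
  intersecting family \<open>{{x}}\<close> with \<open>k = 1\<close> is removed.\<close>

lemma tr_empty: "tr {} = 0"
proof -
  have "tr ({} :: 'a set set) \<le> enat (card ({} :: 'a set))"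
    unfolding tr_def by (rule INF_lower) (simp add: blocking_set_def)
  then show ?thesis by (simp add: zero_enat_def[symmetric])
qed

lemma transversals_nonempty:
  assumes "tr G < \<infinity>"
  shows "transversals G \<noteq> {}"
proof -
  let ?S = "(\<lambda>T. enat (card T)) ` {T. finite T \<and> blocking_set G T}"
  have "?S \<noteq> {}"
    using assms by (force simp: tr_def Inf_enat_def)
  then have "Inf ?S \<in> ?S"
    unfolding Inf_enat_def by (simp only: if_False) (meson LeastI ex_in_conv)
  then show ?thesis
    unfolding transversals_def tr_def by auto
qed

lemma is_MIF_nondegenerate:
  assumes "is_MIF k F"
  shows "F \<noteq> {}" "{} \<notin> F" "0 < k"
proof -
  show ne: "F \<noteq> {}"
    using assms transversals_nonempty[of F] by (auto simp: is_MIF_def)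
  have "blocking_set F B" if "B \<in> F" for B
    using assms that by (auto simp: is_MIF_def transversals_def)
  then show "{} \<notin> F"
    by (auto simp: blocking_set_def)
  with ne assms show "0 < k"
    unfolding is_MIF_def uniform_family_def by (metis card_gt_0_iff all_not_in_conv)
qed

lemma is_CIF_nondegenerate:
  assumes "is_CIF k t F" "0 < t"
  shows "F \<noteq> {}" "{} \<notin> F" "transversals F \<noteq> {}" "{} \<notin> transversals F"
proof -
  show "F \<noteq> {}"
    using assms by (auto simp: is_CIF_def zero_enat_def tr_empty)
  show "{} \<notin> F"
    using assms by (auto simp: is_CIF_def uniform_family_def)
  show "transversals F \<noteq> {}"
    using assms transversals_nonempty[of F] by (simp add: is_CIF_def)
  show "{} \<notin> transversals F"
    using assms by (auto simp: is_CIF_def transversals_def zero_enat_def)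
qed

end

theory Submission
  imports Defs
begin

text \<open>Any point \<open>\<alpha>\<close> of \<open>X\<close> works: take for \<open>F\<close> the blocks avoiding \<open>\<alpha>\<close> and let \<open>G\<close> be the family
  of the blocks through \<open>\<alpha>\<close> with \<open>\<alpha>\<close> removed. Adding \<open>\<alpha>\<close> to a blocking set of \<open>F\<close> gives a blocking
  set of \<open>X\<close>, which has at least \<open>k\<close> points, and is a block of \<open>X\<close> if it has exactly \<open>k\<close> points;
  hence the transversals of \<open>F\<close> are the members of \<open>G\<close>. A blocking set of \<open>F \<union> G\<close> blocks \<open>X\<close> even
  after \<open>\<alpha>\<close> is removed from it, so the transversals of \<open>F \<union> G\<close> are blocks of \<open>X\<close> avoiding \<open>\<alpha>\<close>.\<close>

lemma tr_eqI:
  assumes "finite T" "blocking_set G T"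
    and "\<And>S. finite S \<Longrightarrow> blocking_set G S \<Longrightarrow> card T \<le> card S"
  shows "tr G = enat (card T)"
  unfolding tr_def
proof (rule antisym)
  show "(INF S\<in>{S. finite S \<and> blocking_set G S}. enat (card S)) \<le> enat (card T)"
    using assms by (intro INF_lower) simp
  show "enat (card T) \<le> (INF S\<in>{S. finite S \<and> blocking_set G S}. enat (card S))"
    using assms by (intro INF_greatest) simp
qed

text \<open>This trades the infimum in \<open>enat\<close> for a comparison of natural numbers.
  Finiteness of \<open>tr G\<close> need not be assumed, as \<open>T\<close> itself is a finite
  blocking set.\<close>

lemma transversals_iff:
  "T \<in> transversals G \<longleftrightarrow>
     finite T \<and> blocking_set G T \<and> (\<forall>S. finite S \<longrightarrow> blocking_set G S \<longrightarrow> card T \<le> card S)"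
proof (intro iffI conjI allI impI)
  fix S assume T: "T \<in> transversals G" and S: "finite S" "blocking_set G S"
  have "tr G \<le> enat (card S)"
    unfolding tr_def using S by (intro INF_lower) simp
  then show "card T \<le> card S"
    using T by (simp add: transversals_def flip: enat_ord_simps(1))
qed (auto simp: transversals_def tr_eqI)

text \<open>As \<open>X\<close> is non-empty and consists of its own transversals, the common block
  size \<open>k\<close> is the least size of a finite blocking set.\<close>

lemma is_MIF_iff_blocking_set:
  assumes "is_MIF k X"
  shows "T \<in> X \<longleftrightarrow> finite T \<and> card T = k \<and> blocking_set X T"
    and "finite T \<Longrightarrow> blocking_set X T \<Longrightarrow> k \<le> card T"
proof -
  have X: "B \<in> X \<longleftrightarrow> finite B \<and> blocking_set X B
      \<and> (\<forall>S. finite S \<longrightarrow> blocking_set X S \<longrightarrow> card B \<le> card S)" for B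
    using assms transversals_iff[of B X] by (auto simp: is_MIF_def)
  have card: "card B = k" if "B \<in> X" for B
    using assms that by (simp add: is_MIF_def uniform_family_def)
  obtain B where "B \<in> X"
    using is_MIF_nondegenerate(1)[OF assms] by blast
  then have ge: "k \<le> card S" if "finite S" "blocking_set X S" for S
    using X[of B] card[of B] that by auto
  then show "finite T \<Longrightarrow> blocking_set X T \<Longrightarrow> k \<le> card T" .
  show "T \<in> X \<longleftrightarrow> finite T \<and> card T = k \<and> blocking_set X T"
    using X[of T] card[of T] ge by blast
qed

theorem corollary2p6:
  fixes X :: "'a set set" and k :: nat
  assumes "is_MIF k X"
  shows "\<exists>F \<alpha>. is_CIF k (k - 1) F
           \<and> \<alpha> \<in> points X - points F
           \<and> \<alpha> \<notin> points (transversals F)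
           \<and> F \<inter> point_join \<alpha> (transversals F) = {}
           \<and> X = F \<union> point_join \<alpha> (transversals F)"
proof -
  note X = is_MIF_iff_blocking_set(1)[OF assms] and ge = is_MIF_iff_blocking_set(2)[OF assms]
  have k: "0 < k"
    using is_MIF_nondegenerate(3)[OF assms] .
  obtain A \<alpha> where A: "A \<in> X" "\<alpha> \<in> A"
    using is_MIF_nondegenerate[OF assms] by (metis ex_in_conv)
  define F where "F = {B \<in> X. \<alpha> \<notin> B}"
  define G where "G = {B. \<alpha> \<notin> B \<and> insert \<alpha> B \<in> X}"

  have block_insert: "blocking_set X (insert \<alpha> T)" if "blocking_set F T" for T
    using that by (auto simp: blocking_set_def F_def)
  \<comment> \<open>Blocks of \<open>X\<close> meet pairwise, and \<alpha> lies in no block of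
    \<open>F\<close>, so \<open>insert \<alpha> B\<close> meets these blocks inside
    \<open>B\<close>.\<close>
  have block_F: "blocking_set F B" if "B \<in> G" for B
    using that X[of "insert \<alpha> B"] by (auto simp: blocking_set_def F_def G_def)
  have block_X: "blocking_set X (T - {\<alpha>})" if "blocking_set (F \<union> G) T" for T
    unfolding blocking_set_def
  proof
    fix B assume "B \<in> X"
    then have "B - {\<alpha>} \<in> F \<union> G"
      by (cases "\<alpha> \<in> B") (auto simp: F_def G_def insert_absorb)
    then have "T \<inter> (B - {\<alpha>}) \<noteq> {}"
      using that unfolding blocking_set_def by blast
    then show "(T - {\<alpha>}) \<inter> B \<noteq> {}"
      by blast
  qed
  have ge_F: "k - 1 \<le> card T" if "finite T" "blocking_set F T" for T
    using ge[OF _ block_insert[OF that(2)]] that(1)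
    by (simp add: card_insert_if split: if_splits)
  have ge_FG: "k \<le> card (T - {\<alpha>})" if "finite T" "blocking_set (F \<union> G) T" for T
    using ge[OF _ block_X] that by simp

  have G: "finite B \<and> card B = k - 1" if "B \<in> G" for B
    using that X[of "insert \<alpha> B"] by (auto simp: G_def)
  have AG: "A - {\<alpha>} \<in> G"
    using A by (simp add: G_def insert_absorb)
  have trF: "tr F = enat (k - 1)"
    using tr_eqI[of "A - {\<alpha>}" F] G[OF AG] block_F[OF AG] ge_F by simp
  have trans_F: "transversals F = G"
  proof (intro set_eqI iffI)
    fix T assume "T \<in> transversals F"
    then have T: "finite T" "card T = k - 1" "blocking_set F T"
      using trF by (auto simp: transversals_def)
    then have "k \<le> card (insert \<alpha> T)"
      using ge block_insert by simp
    \<comment> \<open>Otherwise \<open>insert \<alpha> T\<close> is \<open>T\<close>, with only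
      \<open>k - 1 < k\<close> points.\<close>
    then have "\<alpha> \<notin> T"
      using T k by (auto simp: insert_absorb)
    then show "T \<in> G"
      using T k X block_insert by (simp add: G_def)
  next
    fix T assume "T \<in> G"
    then show "T \<in> transversals F"
      using G block_F trF by (simp add: transversals_def)
  qed

  have F_block: "blocking_set (F \<union> G) T" if "T \<in> F" for T
  proof -
    have T: "\<alpha> \<notin> T" "blocking_set X T"
      using that X[of T] by (simp_all add: F_def)
    \<comment> \<open>The blocks \<open>T\<close> and \<open>insert \<alpha> B\<close> of
      \<open>X\<close> meet, and not in \<alpha>.\<close>
    have "T \<inter> B \<noteq> {}" if "B \<in> G" for B
    proof -
      have "T \<inter> insert \<alpha> B \<noteq> {}"
        using T that unfolding blocking_set_def G_def by blast
      then show ?thesis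
        using T by simp
    qed
    then show ?thesis
      using T by (auto simp: blocking_set_def F_def)
  qed
  have "F = transversals (F \<union> G)"
  proof (intro set_eqI iffI)
    fix T assume "T \<in> F"
    then have T: "finite T" "card T = k"
      using X[of T] by (auto simp: F_def)
    have "k \<le> card S" if "finite S" "blocking_set (F \<union> G) S" for S
      using ge_FG[OF that] card_Diff1_le[of S \<alpha>] by linarith
    then show "T \<in> transversals (F \<union> G)"
      using T F_block[OF \<open>T \<in> F\<close>] by (simp add: transversals_iff)
  next
    fix T assume "T \<in> transversals (F \<union> G)"
    then have T: "finite T" "blocking_set (F \<union> G) T"
      and min: "\<And>S. finite S \<Longrightarrow> blocking_set (F \<union> G) S \<Longrightarrow> card T \<le> card S"
      by (auto simp: transversals_iff)
    have "F \<noteq> {}"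
    proof
      \<comment> \<open>This is the degenerate case \<open>k = 1\<close>, in which \<open>{} \<in> G\<close> cannot be blocked.\<close>
      assume "F = {}"
      then have "k - 1 = 0"
        using ge_F[of "{}"] by (simp add: blocking_set_def)
      then have "{} \<in> G"
        using G[OF AG] AG by (metis card_0_eq)
      then show False
        using T by (auto simp: blocking_set_def)
    qed
    then obtain C where "C \<in> F"
      by blast
    \<comment> \<open>The blocking set \<open>C\<close> bounds \<open>card T\<close> by
      \<open>k\<close>, but \<open>T - {\<alpha>}\<close> still has at least \<open>k\<close>
      points, so nothing was removed.\<close>
    then have "card T \<le> k"
      using min F_block X[of C] by (auto simp: F_def)
    then have "card T \<le> card (T - {\<alpha>})"
      using ge_FG[OF T] by linarith
    then have "\<alpha> \<notin> T"
      using T card_Diff1_less[of T \<alpha>] by auto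
    then show "T \<in> F"
      using T X[of T] block_X[OF T(2)] ge_FG[OF T] \<open>card T \<le> k\<close> by (simp add: F_def)
  qed
  moreover have "F \<inter> G = {}"
  proof -
    have "card B = k" if "B \<in> F" for B
      using that X[of B] by (simp add: F_def)
    \<comment> \<open>Sizes separate the two families: \<open>k\<close> differs from
      \<open>k - 1\<close> because \<open>k\<close> is positive.\<close>
    then have "B \<notin> G" if "B \<in> F" for B
      using G[of B] that k by force
    then show ?thesis
      by blast
  qed
  moreover have "uniform_family k F"
    using X by (simp add: uniform_family_def F_def)
  ultimately have "is_CIF k (k - 1) F"
    using trF k diff_less[OF zero_less_one k] unfolding is_CIF_def trans_F by blast
  moreover have "\<alpha> \<in> points X - points F" "\<alpha> \<notin> points G"
    using A by (auto simp: points_def F_def G_def)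
  moreover have "F \<inter> point_join \<alpha> G = {}"
    by (auto simp: F_def point_join_def)
  moreover have "X = F \<union> point_join \<alpha> G"
  proof (intro set_eqI iffI)
    fix B assume B: "B \<in> X"
    have "B - {\<alpha>} \<in> G" "B = insert \<alpha> (B - {\<alpha>})" if "\<alpha> \<in> B"
      using B that by (simp_all add: G_def insert_absorb)
    then show "B \<in> F \<union> point_join \<alpha> G"
      using B unfolding F_def point_join_def by blast
  qed (auto simp: F_def G_def point_join_def)
  ultimately show ?thesis
    unfolding trans_F[symmetric] by blast
qed

end
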